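(* Consider an ontological model of a quantum system $S$, whether or not its projective measurements are outcome deterministic. Let $\Pi_{E_{i_0}}=|\psi_{i_0}\rangle\langle\psi_{i_0}|$ be a rank-1 projective measurement, measured jointly with further rank-1 projective measurements $\Pi_{E_i}=|\psi_i\rangle\langle\psi_i|$ ($i\neq i_0$) such that $\psi_{i_0}$ and the $\psi_i$ ($i\neq i_0$) form an orthonormal basis; depending on the measurement setting, the orthonormal states $\psi_i$ ($i\neq i_0$) are rotated unitarily from one set to another within the subspace $1-\Pi_{E_{i_0}}$. Then only ontic states that are outside the support of $1-\Pi_{E_{i_0}}$ and outside the support of $\psi_{i_0}$ can be contextual to $\Pi_{E_{i_0}}$. That is, every ontic state that belongs to the support of some quantum state in the subspace $1-\Pi_{E_{i_0}}$, and every ontic state that belongs to the support of $\psi_{i_0}$, is noncontextual to $\Pi_{E_{i_0}}$.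
   Context: An ontological model of a quantum system $S$ has an ontological space $\Lambda$, whose points $\lambda$ are called ontic states, with a measure over ontic states written $d\lambda$. For each pure quantum state $\psi$ and each preparation setting $P$ of $\psi$ there is a probability distribution $\rho(\lambda|\psi,P)$ over $\Lambda$. For each POVM $\{E_i\}$ ($E_i\ge 0$, $\sum_iE_i=1$; projective measurements are a special case) and each measurement setting $M$ implementing it, there are indicator functions $\xi_{E_i}(\lambda,M)$, giving the probability that the ontic state $\lambda$ responds with outcome $E_i$, with $\sum_i\xi_{E_i}(\lambda,M)=1$. The model reproduces Born's rule for all settings: $\int d\lambda\,\xi_{E_i}(\lambda,M)\rho(\lambda|\psi,P)=\langle\psi|E_i|\psi\rangle$. Projective measurements are outcome deterministic if $\xi_{E_i}^2(\lambda,M)=\xi_{E_i}(\lambda,M)$. The support of a quantum state $\psi$ is the union of the supports of $\rho(\lambda|\psi,P)$ over all possible preparation settings $P$ of $\psi$. The subspace $1-\Pi_{E_{i_0}}$ is the orthogonal complement of $\psi_{i_0}$ in the Hilbert space, and the support of $1-\Pi_{E_{i_0}}$ consists of the ontic states that belong to the support of some quantum state in this subspace. An ontic state $\lambda$ is contextual to $\Pi_{E_{i_0}}$ if its response $\xi_{E_{i_0}}(\lambda,M)$ depends on the setting $M$ (i.e. on which other projective measurements are performed jointly with $\Pi_{E_{i_0}}$), and noncontextual to $\Pi_{E_{i_0}}$ otherwise.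
   Formalization: "Every ontic state" fails on null sets of dλ; proved instead: almost every ontic state for countably many settings, every ontic state of positive measure for all settings, and, for σ-finite dλ, every ontic state after changing ρ and ξ on null sets. *)

theory Defs
  imports "HOL-Analysis.Analysis"
begin

text \<open>
  The distribution has no class of complex inner product spaces. The class below extends
  \<^class>\<open>real_inner\<close>, whose norm, metric and topology it uses; \<open>cinner\<close> is linear in its
  second argument, as in the bra-ket notation. Positive definiteness is inherited through
  \<open>inner_eq_Re_cinner\<close>. No restriction is placed on the dimension.
\<close>

class complex_inner = real_inner +
  fixes scaleC :: "complex \<Rightarrow> 'a \<Rightarrow> 'a"  (infixr "*\<^sub>C" 75)
    and cinner :: "'a \<Rightarrow> 'a \<Rightarrow> complex"
  assumes scaleC_add_right: "c *\<^sub>C (x + y) = c *\<^sub>C x + c *\<^sub>C y"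
    and scaleC_add_left: "(c + d) *\<^sub>C x = c *\<^sub>C x + d *\<^sub>C x"
    and scaleC_scaleC: "c *\<^sub>C (d *\<^sub>C x) = (c * d) *\<^sub>C x"
    and scaleR_eq_scaleC: "r *\<^sub>R x = complex_of_real r *\<^sub>C x"
    and cinner_commute: "cinner x y = cnj (cinner y x)"
    and cinner_add_right: "cinner x (y + z) = cinner x y + cinner x z"
    and cinner_scaleC_right: "cinner x (c *\<^sub>C y) = c * cinner x y"
    and inner_eq_Re_cinner: "x \<bullet> y = Re (cinner x y)"

class complex_hilbert = complex_inner + complete_space

text \<open>The spaces \<open>complex ^ 'n\<close> are instances.\<close>

instantiation complex :: complex_hilbert
begin

definition scaleC_complex :: "complex \<Rightarrow> complex \<Rightarrow> complex"
  where "scaleC_complex c x = c * x"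

definition cinner_complex :: "complex \<Rightarrow> complex \<Rightarrow> complex"
  where "cinner_complex x y = cnj x * y"

instance
  by standard
    (simp_all add: scaleC_complex_def cinner_complex_def algebra_simps scaleR_conv_of_real
      inner_complex_def)

end

instantiation vec :: (complex_hilbert, finite) complex_hilbert
begin

definition scaleC_vec :: "complex \<Rightarrow> 'a ^ 'b \<Rightarrow> 'a ^ 'b"
  where "scaleC_vec c x = (\<chi> i. c *\<^sub>C (x $ i))"

definition cinner_vec :: "'a ^ 'b \<Rightarrow> 'a ^ 'b \<Rightarrow> complex"
  where "cinner_vec x y = (\<Sum>i\<in>UNIV. cinner (x $ i) (y $ i))"

instance
proof
  fix c d :: complex and r :: real and x y z :: "'a ^ 'b"
  show "cinner x y = cnj (cinner y x)"
    unfolding cinner_vec_def cnj_sum by (rule sum.cong[OF refl]) (rule cinner_commute)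
qed (simp_all add: scaleC_vec_def cinner_vec_def vec_eq_iff scaleC_add_right scaleC_add_left
      scaleC_scaleC scaleR_eq_scaleC cinner_add_right cinner_scaleC_right inner_vec_def
      inner_eq_Re_cinner sum.distrib sum_distrib_left)

end

text \<open>\<open>ketbra \<psi>\<close> is $|\psi\rangle\langle\psi|$. Two unit vectors represent the same pure state
  (differ by a phase) iff they have the same \<open>ketbra\<close>.\<close>

definition ketbra :: "'h::complex_inner \<Rightarrow> 'h \<Rightarrow> 'h"
  where "ketbra \<psi> = (\<lambda>\<phi>. cinner \<psi> \<phi> *\<^sub>C \<psi>)"

definition orthonormal_basis :: "'i set \<Rightarrow> ('i \<Rightarrow> 'h::complex_hilbert) \<Rightarrow> bool"
  where "orthonormal_basis I b \<longleftrightarrow>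
    (\<forall>i\<in>I. \<forall>j\<in>I. cinner (b i) (b j) = (if i = j then 1 else 0)) \<and>
    (\<forall>\<phi>. ((\<lambda>i. cinner (b i) \<phi> *\<^sub>C b i) has_sum \<phi>) I)"

definition positive_operator :: "('h::complex_hilbert \<Rightarrow> 'h) \<Rightarrow> bool"
  where "positive_operator E \<longleftrightarrow>
    bounded_linear E \<and> (\<forall>c \<phi>. E (c *\<^sub>C \<phi>) = c *\<^sub>C E \<phi>) \<and>
    (\<forall>\<phi>. Im (cinner \<phi> (E \<phi>)) = 0 \<and> Re (cinner \<phi> (E \<phi>)) \<ge> 0)"

definition povm :: "'i set \<Rightarrow> ('i \<Rightarrow> 'h::complex_hilbert \<Rightarrow> 'h) \<Rightarrow> bool"
  where "povm I E \<longleftrightarrow>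
    (\<forall>i\<in>I. positive_operator (E i)) \<and> (\<forall>\<phi>. ((\<lambda>i. E i \<phi>) has_sum \<phi>) I)"

text \<open>
  A preparation setting \<open>P :: 'p\<close> carries the state it prepares and a measurement setting
  \<open>M :: 'm\<close> carries the POVM it implements, so \<open>rho P\<close> is $\rho(\cdot|\psi,P)$ with
  $\psi$ = \<open>prepared P\<close>, and \<open>xi M i\<close> is $\xi_{E_i}(\cdot,M)$ with $E_i$ = \<open>effect M i\<close>.
  A label shared by several states or POVMs is rendered by pairing it with the state or POVM.
  Different settings may prepare the same state, or implement the same POVM.
\<close>

record ('h, 'l, 'p, 'm, 'i) ontic_data =
  ontic :: "'l measure"
  prepared :: "'p \<Rightarrow> 'h"
  rho :: "'p \<Rightarrow> 'l \<Rightarrow> real"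
  outcomes :: "'m \<Rightarrow> 'i set"
  effect :: "'m \<Rightarrow> 'i \<Rightarrow> 'h \<Rightarrow> 'h"
  xi :: "'m \<Rightarrow> 'i \<Rightarrow> 'l \<Rightarrow> real"

definition ontological_model :: "('h::complex_hilbert, 'l, 'p, 'm, 'i) ontic_data \<Rightarrow> bool"
  where "ontological_model S \<longleftrightarrow>
    (\<forall>P. norm (prepared S P) = 1 \<and>
      (\<forall>l\<in>space (ontic S). rho S P l \<ge> 0) \<and>
      integrable (ontic S) (rho S P) \<and> (LINT l|ontic S. rho S P l) = 1) \<and>
    (\<forall>M. povm (outcomes S M) (effect S M) \<and>
      (\<forall>i\<in>outcomes S M. xi S M i \<in> borel_measurable (ontic S)) \<and>
      (\<forall>l\<in>space (ontic S).
        (\<forall>i\<in>outcomes S M. xi S M i l \<ge> 0) \<and>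
        ((\<lambda>i. xi S M i l) has_sum 1) (outcomes S M))) \<and>
    (\<forall>P M. \<forall>i\<in>outcomes S M.
      complex_of_real (LINT l|ontic S. xi S M i l * rho S P l) =
      cinner (prepared S P) (effect S M i (prepared S P)))"

text \<open>
  The following notions are relative to a set \<open>Ps\<close> of preparation settings or a set \<open>Ms\<close> of
  measurement settings; \<^term>\<open>UNIV\<close> gives the notions relative to all settings of the model.
  Subsets matter because Born's rule leaves an exceptional null set for every single setting, and
  an uncountable union of null sets need not be null.
\<close>

definition state_support ::
    "('h::complex_hilbert, 'l, 'p, 'm, 'i) ontic_data \<Rightarrow> 'p set \<Rightarrow> 'h \<Rightarrow> 'l set"
  where "state_support S Ps \<psi> =
    (\<Union>P\<in>{P\<in>Ps. ketbra (prepared S P) = ketbra \<psi>}. {l\<in>space (ontic S). rho S P l > 0})"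

definition orthocomplement_support ::
    "('h::complex_hilbert, 'l, 'p, 'm, 'i) ontic_data \<Rightarrow> 'p set \<Rightarrow> 'h \<Rightarrow> 'l set"
  where "orthocomplement_support S Ps \<psi> =
    (\<Union>\<phi>\<in>{\<phi>. norm \<phi> = 1 \<and> cinner \<psi> \<phi> = 0}. state_support S Ps \<phi>)"

text \<open>
  \<open>M\<close> measures \<open>ketbra \<psi>\<close> (outcome \<open>i0\<close>) jointly with the rank-1 projectors of the other
  vectors of an orthonormal basis. The bases containing \<open>\<psi>\<close> are exactly those obtained from one
  of them by unitary rotations within the orthocomplement of \<open>\<psi>\<close>.
\<close>

definition joint_setting ::
    "('h::complex_hilbert, 'l, 'p, 'm, 'i) ontic_data \<Rightarrow> 'h \<Rightarrow> 'm \<Rightarrow> 'i \<Rightarrow> bool"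
  where "joint_setting S \<psi> M i0 \<longleftrightarrow>
    (\<exists>b. orthonormal_basis (outcomes S M) b \<and> i0 \<in> outcomes S M \<and> b i0 = \<psi> \<and>
      (\<forall>i\<in>outcomes S M. effect S M i = ketbra (b i)))"

definition contextual ::
    "('h::complex_hilbert, 'l, 'p, 'm, 'i) ontic_data \<Rightarrow> 'm set \<Rightarrow> 'h \<Rightarrow> 'l \<Rightarrow> bool"
  where "contextual S Ms \<psi> l \<longleftrightarrow>
    (\<exists>M\<in>Ms. \<exists>M'\<in>Ms. \<exists>i i'. joint_setting S \<psi> M i \<and> joint_setting S \<psi> M' i' \<and>
      xi S M i l \<noteq> xi S M' i' l)"

abbreviation noncontextual ::
    "('h::complex_hilbert, 'l, 'p, 'm, 'i) ontic_data \<Rightarrow> 'm set \<Rightarrow> 'h \<Rightarrow> 'l \<Rightarrow> bool"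
  where "noncontextual S Ms \<psi> l \<equiv> \<not> contextual S Ms \<psi> l"

text \<open>
  A model constrains each density and each indicator function only through integrals, hence up
  to null sets. \<open>version_of S' S\<close>: \<open>S'\<close> is a model of the same system with the same settings, and
  each of its densities and indicator functions agrees almost everywhere with that of \<open>S\<close>.
\<close>

definition version_of ::
    "('h::complex_hilbert, 'l, 'p, 'm, 'i) ontic_data \<Rightarrow>
     ('h, 'l, 'p, 'm, 'i) ontic_data \<Rightarrow> bool"
  where "version_of S' S \<longleftrightarrow>
    ontological_model S' \<and>
    ontic S' = ontic S \<and> prepared S' = prepared S \<and>
    outcomes S' = outcomes S \<and> effect S' = effect S \<and>
    (\<forall>P. AE l in ontic S. rho S' P l = rho S P l) \<and>
    (\<forall>M. \<forall>i\<in>outcomes S M. AE l in ontic S. xi S' M i l = xi S M i l)"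

end

theory Submission
  imports Defs
begin

text \<open>
  By Born's rule $\int \xi\rho$ is 0 for a state orthogonal to $\psi$ and 1 for $\psi$ itself;
  since $0 \le \xi \le 1$, the response $\xi$ is 0, respectively 1, almost everywhere on the support
  of the density, whatever the setting. This settles countably many settings and atoms. In general,
  $\sigma$-finiteness provides countable unions of supports that contain all the supports up to null
  sets; the densities are cut off outside these unions, and on the null set where an indicator
  function has the wrong value there, it is replaced by a deterministic response.
\<close>

section \<open>Unit vectors, rank-1 projectors and orthonormal bases\<close>

lemma scaleC_one: "1 *\<^sub>C x = (x :: 'a::complex_inner)"
  by (metis of_real_1 scaleR_eq_scaleC scaleR_one)

lemma cinner_self_unit:
  assumes "norm (x :: 'a::complex_inner) = 1"
  shows "cinner x x = 1"
proof (rule complex_eqI)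
  show "Re (cinner x x) = Re 1"
    using assms by (simp add: inner_eq_Re_cinner[symmetric] norm_eq_1)
  show "Im (cinner x x) = Im 1"
    using arg_cong[OF cinner_commute[of x x], of Im] by simp
qed

lemma scaleC_zero_left: "0 *\<^sub>C x = (0 :: 'a::complex_inner)"
  using scaleC_add_left[of 0 0 x] by simp

lemma ketbra_self:
  assumes "norm x = 1"
  shows "ketbra x x = x"
  by (simp add: ketbra_def cinner_self_unit[OF assms] scaleC_one)

text \<open>Apply both operators to \<open>x\<close>: the left one fixes it, the right one produces
  a multiple of \<open>y\<close>.\<close>

lemma ketbra_eqD:
  assumes "norm x = 1" "ketbra x = ketbra y"
  shows "x = cinner y x *\<^sub>C y"
  using ketbra_self[OF assms(1)] unfolding assms(2) by (simp add: ketbra_def)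

text \<open>Writing \<open>x\<close> as \<open>c\<close> times \<open>y\<close> with
  \<open>c = cinner y x\<close>, the normalization of \<open>x\<close> becomes
  \<open>c * cnj c = 1\<close>.\<close>

lemma cmod_cinner_ketbra_eq:
  assumes "norm x = 1" "ketbra x = ketbra y"
  shows "cmod (cinner y x) = 1"
proof -
  have "1 = cinner x x"
    by (simp add: cinner_self_unit[OF assms(1)])
  also have "\<dots> = cinner y x * cnj (cinner y x)"
    by (metis assms cinner_commute cinner_scaleC_right ketbra_eqD)
  finally have "of_real ((cmod (cinner y x))\<^sup>2) = (of_real 1 :: complex)"
    by (simp add: complex_norm_square del: of_real_power)
  then have "(cmod (cinner y x))\<^sup>2 = 1"
    by (simp only: of_real_eq_iff)
  then show ?thesis
    by (simp add: power2_eq_1_iff) (smt (verit) norm_ge_zero)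
qed

lemma cinner_ketbra:
  "cinner \<phi> (ketbra \<psi> \<phi>) = complex_of_real ((cmod (cinner \<psi> \<phi>))\<^sup>2)"
  unfolding ketbra_def cinner_scaleC_right complex_norm_square
  by (metis cinner_commute)

text \<open>If \<open>i\<close> were the only possible index, every term in the expansion of
  \<open>\<phi>\<close> would vanish. This later supplies an outcome to take over when the response
  of \<open>i\<close> is set to 0.\<close>

lemma orthonormal_basis_ex_other:
  assumes "orthonormal_basis I b" "cinner (b i) \<phi> = 0" "\<phi> \<noteq> 0"
  obtains j where "j \<in> I" "j \<noteq> i"
proof -
  have "False" if "I \<subseteq> {i}"
  proof -
    have "((\<lambda>k. cinner (b k) \<phi> *\<^sub>C b k) has_sum \<phi>) I"
      using assms(1) by (simp add: orthonormal_basis_def)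
    moreover have "((\<lambda>k. cinner (b k) \<phi> *\<^sub>C b k) has_sum 0) I"
      using that assms(2) by (intro has_sum_0) (auto simp: scaleC_zero_left)
    ultimately show False
      using assms(3) has_sum_unique by blast
  qed
  then show ?thesis
    using that by blast
qed

section \<open>Joint settings, supports and atoms\<close>

lemma joint_setting_outcome: "joint_setting S \<psi> M i \<Longrightarrow> i \<in> outcomes S M"
  by (auto simp: joint_setting_def)

text \<open>The two outcomes may come with different bases. In the first basis, \<open>b i'\<close>
  spans the same ray as \<open>\<psi>\<close>, which is \<open>b i\<close>; distinct basis vectors
  are orthogonal, so this is impossible.\<close>

lemma joint_setting_unique:
  assumes "norm \<psi> = 1" "joint_setting S \<psi> M i" "joint_setting S \<psi> M i'"
  shows "i = i'"
proof (rule ccontr)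
  assume "i \<noteq> i'"
  obtain b where b: "orthonormal_basis (outcomes S M) b" "i \<in> outcomes S M" "b i = \<psi>"
      "\<forall>k\<in>outcomes S M. effect S M k = ketbra (b k)"
    using assms(2) by (auto simp: joint_setting_def)
  obtain b' where b': "i' \<in> outcomes S M" "b' i' = \<psi>"
      "\<forall>k\<in>outcomes S M. effect S M k = ketbra (b' k)"
    using assms(3) by (auto simp: joint_setting_def)
  have "ketbra \<psi> = ketbra (b i')"
    using b b' by auto
  then have "cmod (cinner (b i') \<psi>) = 1"
    using assms(1) cmod_cinner_ketbra_eq by blast
  moreover have "cinner (b i') (b i) = 0"
    using b b' \<open>i \<noteq> i'\<close> unfolding orthonormal_basis_def by auto
  ultimately show False
    using b(3) by simp
qed

text \<open>Equal projectors mean proportional vectors, so orthogonality to \<open>\<psi>\<close>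
  passes from \<open>\<phi>\<close> to the prepared vector. Conversely the prepared vector itself
  serves as \<open>\<phi>\<close>.\<close>

lemma orthocomplement_support_eq:
  assumes "\<And>P. norm (prepared S P) = 1"
  shows "orthocomplement_support S Ps \<psi> =
    (\<Union>P\<in>{P\<in>Ps. cinner \<psi> (prepared S P) = 0}. {l\<in>space (ontic S). rho S P l > 0})"
proof -
  have "cinner \<psi> (prepared S P) = 0"
    if "ketbra (prepared S P) = ketbra \<phi>" "cinner \<psi> \<phi> = 0" for P \<phi>
    by (metis assms cinner_scaleC_right ketbra_eqD mult_zero_right that)
  then show ?thesis
    using assms unfolding orthocomplement_support_def state_support_def by auto
qed

lemma noncontextualI:
  assumes "\<And>M i. M \<in> Ms \<Longrightarrow> joint_setting S \<psi> M i \<Longrightarrow> xi S M i l = c"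
  shows "noncontextual S Ms \<psi> l"
  using assms by (auto simp: contextual_def)

text \<open>A null set cannot contain a point of positive measure.\<close>

lemma AE_at_atom:
  assumes "emeasure N {l} > 0" "AE x in N. Q x"
  shows "Q l"
proof (rule ccontr)
  assume "\<not> Q l"
  \<comment> \<open>A nonmeasurable set has \<open>emeasure\<close> 0 by convention, so positivity
    forces measurability.\<close>
  have l: "{l} \<in> sets N"
    using assms(1) emeasure_notin_sets by fastforce
  then have "l \<in> space N"
    using sets.sets_into_space by blast
  obtain K where "{x\<in>space N. \<not> Q x} \<subseteq> K" "emeasure N K = 0" "K \<in> sets N"
    using assms(2) by (rule AE_E)
  then have "emeasure N {l} \<le> 0"
    using emeasure_mono[of "{l}" K N] \<open>\<not> Q l\<close> \<open>l \<in> space N\<close> by auto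
  then show False
    using assms(1) by simp
qed

section \<open>Consequences of Born's rule for a fixed model\<close>

context
  fixes S :: "('h::complex_hilbert, 'l, 'p, 'm, 'i) ontic_data"
  assumes model: "ontological_model S"
begin

lemma norm_prepared: "norm (prepared S P) = 1"
  and rho_nonneg: "l \<in> space (ontic S) \<Longrightarrow> rho S P l \<ge> 0"
  and rho_integrable: "integrable (ontic S) (rho S P)"
  and rho_integral: "(LINT l|ontic S. rho S P l) = 1"
  and xi_measurable: "i \<in> outcomes S M \<Longrightarrow> xi S M i \<in> borel_measurable (ontic S)"
  and xi_nonneg: "l \<in> space (ontic S) \<Longrightarrow> i \<in> outcomes S M \<Longrightarrow> xi S M i l \<ge> 0"
  and xi_has_sum: "l \<in> space (ontic S) \<Longrightarrow> ((\<lambda>i. xi S M i l) has_sum 1) (outcomes S M)"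
  and born: "i \<in> outcomes S M \<Longrightarrow> complex_of_real (LINT l|ontic S. xi S M i l * rho S P l) =
      cinner (prepared S P) (effect S M i (prepared S P))"
  using model by (auto simp: ontological_model_def)

lemma rho_measurable: "rho S P \<in> borel_measurable (ontic S)"
  using rho_integrable by (rule borel_measurable_integrable)

lemma support_in_sets: "{l\<in>space (ontic S). rho S P l > 0} \<in> sets (ontic S)"
  using rho_measurable[of P] by measurable

text \<open>The one-term sum at \<open>i\<close> is compared with the full sum 1 of nonnegative
  terms; there may be infinitely many outcomes.\<close>

lemma xi_le_one:
  assumes "l \<in> space (ontic S)" "i \<in> outcomes S M"
  shows "xi S M i l \<le> 1"
proof -
  have "((\<lambda>k. xi S M k l) has_sum xi S M i l) {i}"
    using has_sum_finite[of "{i}" "\<lambda>k. xi S M k l"] by simp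
  then show ?thesis
    using assms xi_nonneg by (rule_tac has_sum_mono2[OF _ xi_has_sum[OF assms(1), of M]]) auto
qed

text \<open>The density dominates the product. Integrability matters because the Bochner integral of
  a nonintegrable function is 0 by default, so a zero integral alone would say nothing.\<close>

lemma xi_rho_integrable:
  assumes "i \<in> outcomes S M"
  shows "integrable (ontic S) (\<lambda>l. xi S M i l * rho S P l)"
proof (rule Bochner_Integration.integrable_bound[OF rho_integrable[of P]])
  show "(\<lambda>l. xi S M i l * rho S P l) \<in> borel_measurable (ontic S)"
    using xi_measurable[OF assms] rho_measurable[of P] by measurable
  show "AE l in ontic S. norm (xi S M i l * rho S P l) \<le> norm (rho S P l)"
    using xi_nonneg[OF _ assms] xi_le_one[OF _ assms] rho_nonneg
    by (intro AE_I2) (simp add: abs_mult mult_left_le_one_le)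
qed

lemma born_joint_setting:
  assumes "joint_setting S \<psi> M i"
  shows "(LINT l|ontic S. xi S M i l * rho S P l) = (cmod (cinner \<psi> (prepared S P)))\<^sup>2"
proof -
  have "effect S M i = ketbra \<psi>"
    using assms by (auto simp: joint_setting_def)
  then show ?thesis
    using born[OF joint_setting_outcome[OF assms], of P] cinner_ketbra[of "prepared S P" \<psi>]
    by (simp only: of_real_eq_iff)
qed

text \<open>A nonnegative integrand with integral 0 vanishes almost everywhere; where the density is
  positive, the other factor must vanish.\<close>

lemma AE_xi_eq_0:
  assumes "joint_setting S \<psi> M i" "cinner \<psi> (prepared S P) = 0"
  shows "AE l in ontic S. rho S P l > 0 \<longrightarrow> xi S M i l = 0"
proof -
  note i = joint_setting_outcome[OF assms(1)]
  have "AE l in ontic S. xi S M i l * rho S P l = 0"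
    using born_joint_setting[OF assms(1), of P] assms(2) xi_nonneg[OF _ i] rho_nonneg
    by (subst integral_nonneg_eq_0_iff_AE[OF xi_rho_integrable[OF i], symmetric]) auto
  then show ?thesis
    by eventually_elim auto
qed

text \<open>The same argument for the density times one minus the response: its integral is 1 - 1,
  the overlap of the prepared vector with \<open>\<psi>\<close> having modulus 1.\<close>

lemma AE_xi_eq_1:
  assumes "joint_setting S \<psi> M i" "ketbra (prepared S P) = ketbra \<psi>"
  shows "AE l in ontic S. rho S P l > 0 \<longrightarrow> xi S M i l = 1"
proof -
  note i = joint_setting_outcome[OF assms(1)]
  have "(LINT l|ontic S. rho S P l - xi S M i l * rho S P l) = 0"
    using born_joint_setting[OF assms(1), of P] cmod_cinner_ketbra_eq[OF norm_prepared assms(2)]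
    by (simp add: Bochner_Integration.integral_diff[OF rho_integrable xi_rho_integrable[OF i]]
        rho_integral)
  moreover have "AE l in ontic S. 0 \<le> rho S P l - xi S M i l * rho S P l"
    using xi_nonneg[OF _ i] xi_le_one[OF _ i] rho_nonneg
    by (intro AE_I2) (simp add: mult_left_le_one_le)
  ultimately have "AE l in ontic S. rho S P l - xi S M i l * rho S P l = 0"
    using integral_nonneg_eq_0_iff_AE[OF Bochner_Integration.integrable_diff[OF
          rho_integrable xi_rho_integrable[OF i]]] by blast
  then show ?thesis
    by eventually_elim auto
qed

text \<open>Each pair of a measurement and a preparation setting has its own exceptional null set;
  countably many of these have a null union.\<close>

lemma AE_noncontextual_countable:
  assumes "norm \<psi> = 1" "countable Ps" "countable Ms"
  shows "AE l in ontic S. l \<in> orthocomplement_support S Ps \<psi> \<union> state_support S Ps \<psi> \<longrightarrow>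
    noncontextual S Ms \<psi> l"
proof -
  \<comment> \<open>The type of outcomes may be uncountable. Attaching to each setting its unique
    outcome for \<open>\<psi>\<close> leaves only the settings to quantify over.\<close>
  define i0 where "i0 M = (THE i. joint_setting S \<psi> M i)" for M
  have i0: "i0 M = i" if "joint_setting S \<psi> M i" for M i
    unfolding i0_def using that joint_setting_unique[OF assms(1) _ that] by (rule the_equality)
  let ?Ms = "{M\<in>Ms. joint_setting S \<psi> M (i0 M)}"
  have "AE l in ontic S. \<forall>M\<in>?Ms. \<forall>P\<in>{P\<in>Ps. cinner \<psi> (prepared S P) = 0}.
      rho S P l > 0 \<longrightarrow> xi S M (i0 M) l = 0"
    using assms by (intro AE_ball_countable' AE_xi_eq_0) auto
  moreover have "AE l in ontic S. \<forall>M\<in>?Ms. \<forall>P\<in>{P\<in>Ps. ketbra (prepared S P) = ketbra \<psi>}.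
      rho S P l > 0 \<longrightarrow> xi S M (i0 M) l = 1"
    using assms by (intro AE_ball_countable' AE_xi_eq_1) auto
  ultimately show ?thesis
  proof eventually_elim
    case (elim l)
    show ?case
    proof
      assume "l \<in> orthocomplement_support S Ps \<psi> \<union> state_support S Ps \<psi>"
      then consider
          P where "P \<in> Ps" "cinner \<psi> (prepared S P) = 0" "rho S P l > 0"
        | P where "P \<in> Ps" "ketbra (prepared S P) = ketbra \<psi>" "rho S P l > 0"
        by (auto simp: orthocomplement_support_eq[OF norm_prepared] state_support_def)
      then show "noncontextual S Ms \<psi> l"
      proof cases
        case 1
        then show ?thesis
          using elim(1) i0 by (intro noncontextualI[where c = 0]) fastforce
      next
        case 2
        then show ?thesis
          using elim(2) i0 by (intro noncontextualI[where c = 1]) fastforce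
      qed
    qed
  qed
qed

text \<open>The exceptional null set of each single pair of settings misses the atom, so no union
  over settings is formed.\<close>

lemma noncontextual_atom:
  assumes "emeasure (ontic S) {l} > 0"
    and "l \<in> orthocomplement_support S UNIV \<psi> \<union> state_support S UNIV \<psi>"
  shows "noncontextual S UNIV \<psi> l"
  using assms(2)
proof
  assume "l \<in> orthocomplement_support S UNIV \<psi>"
  then obtain P where "cinner \<psi> (prepared S P) = 0" "rho S P l > 0"
    by (auto simp: orthocomplement_support_eq[OF norm_prepared])
  then show ?thesis
    using AE_at_atom[OF assms(1) AE_xi_eq_0] by (intro noncontextualI[where c = 0]) blast
next
  assume "l \<in> state_support S UNIV \<psi>"
  then obtain P where "ketbra (prepared S P) = ketbra \<psi>" "rho S P l > 0"
    by (auto simp: state_support_def)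
  then show ?thesis
    using AE_at_atom[OF assms(1) AE_xi_eq_1] by (intro noncontextualI[where c = 1]) blast
qed

end

section \<open>Essential unions of uncountable families of measurable sets\<close>

text \<open>Exhaustion: among the countable subfamilies, take one whose union is largest for a
  suitable finite measure. Adding another member cannot enlarge it, so what that member contributes
  is null.\<close>

lemma (in sigma_finite_measure) countable_essential_Union:
  assumes "F \<subseteq> sets M"
  obtains C where "C \<subseteq> F" "countable C" "\<And>A. A \<in> F \<Longrightarrow> A - \<Union>C \<in> null_sets M"
proof -
  \<comment> \<open>A strictly positive integrable density turns \<open>M\<close> into a finite
    measure \<open>N\<close> whose null sets are null for \<open>M\<close>.\<close>
  obtain h where h: "h \<in> borel_measurable M" "integral\<^sup>N M h \<noteq> \<infinity>"
      "\<And>x. x \<in> space M \<Longrightarrow> 0 < h x \<and> h x < \<infinity>"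
    using Ex_finite_integrable_function by blast
  define N where "N = density M h"
  have setsN: "sets N = sets M"
    by (simp add: N_def)
  interpret N: finite_measure N
  proof
    show "emeasure N (space N) \<noteq> \<infinity>"
      using h by (simp add: N_def emeasure_density cong: nn_integral_cong)
  qed
  have null: "A \<in> null_sets M" if "A \<in> null_sets N" for A
  proof -
    have "A \<in> sets M" "AE x in M. x \<in> A \<longrightarrow> h x = 0"
      using that h(1) by (auto simp: N_def null_sets_density_iff)
    from this(2) AE_space have "AE x in M. x \<notin> A"
      by eventually_elim (use h(3) in force)
    then show ?thesis
      using \<open>A \<in> sets M\<close> by (simp add: AE_iff_null_sets)
  qed
  let ?K = "{C. C \<subseteq> F \<and> countable C}"
  let ?m = "\<lambda>C. emeasure N (\<Union>C)"
  have "?K \<noteq> {}"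
    by auto
  \<comment> \<open>A sequence of countable subfamilies approaches the supremum; their union
    \<open>C\<close> is again countable and attains it.\<close>
  then obtain f :: "nat \<Rightarrow> ennreal"
    where f: "range f \<subseteq> ?m ` ?K" "Sup (?m ` ?K) = Sup (range f)"
    using ennreal_SUP_countable_SUP[of ?K ?m] by blast
  have "\<forall>n. \<exists>C. C \<in> ?K \<and> f n = ?m C"
    using f(1) by (auto simp: image_subset_iff image_iff)
  from choice[OF this] obtain D where "\<forall>n. D n \<in> ?K \<and> f n = ?m (D n)" ..
  then have D: "D n \<in> ?K" "f n = ?m (D n)" for n
    by auto
  define C where "C = (\<Union>n. D n)"
  have C: "C \<in> ?K"
    using D(1) by (auto simp: C_def)
  have UN_sets: "\<Union>B \<in> sets N" if "B \<in> ?K" for B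
    using that assms setsN by (intro sets.countable_Union) auto
  have max: "?m B \<le> ?m C" if "B \<in> ?K" for B
  proof -
    have "?m B \<le> Sup (range f)"
      unfolding f(2)[symmetric] using that by (rule SUP_upper)
    also have "\<dots> \<le> ?m C"
      using D(2) UN_sets[OF C] by (auto simp: C_def intro!: SUP_least emeasure_mono)
    finally show ?thesis .
  qed
  have "A - \<Union>C \<in> null_sets M" if A: "A \<in> F" for A
  proof -
    have AN: "A \<in> sets N"
      using A assms setsN by auto
    \<comment> \<open>By maximality the new part adds nothing; finiteness of \<open>N\<close> allows
      \<open>?m C\<close> to be cancelled.\<close>
    have "?m C + emeasure N (A - \<Union>C) = emeasure N (\<Union>C \<union> (A - \<Union>C))"
      using AN UN_sets[OF C] by (intro plus_emeasure) auto
    also have "\<dots> = ?m (insert A C)"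
      by (rule arg_cong[where f = "emeasure N"]) auto
    also have "\<dots> \<le> ?m C"
      using A C by (intro max) auto
    finally have "emeasure N (A - \<Union>C) = 0"
      using N.emeasure_finite[of "\<Union>C"]
      by (metis add.right_neutral ennreal_add_left_cancel_le le_zero_eq infinity_ennreal_def)
    then show ?thesis
      using AN UN_sets[OF C] by (intro null) auto
  qed
  then show ?thesis
    using that C by auto
qed

text \<open>Keeping a countable set of indices rather than of sets provides the countably many
  preparation settings to which the almost-everywhere results apply.\<close>

lemma (in sigma_finite_measure) countable_essential_UN:
  assumes "\<And>x. x \<in> X \<Longrightarrow> A x \<in> sets M"
  obtains Y where "Y \<subseteq> X" "countable Y" "\<And>x. x \<in> X \<Longrightarrow> A x - (\<Union>y\<in>Y. A y) \<in> null_sets M"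
proof -
  obtain C where C: "C \<subseteq> A ` X" "countable C" "\<And>B. B \<in> A ` X \<Longrightarrow> B - \<Union>C \<in> null_sets M"
    using countable_essential_Union[of "A ` X"] assms by blast
  then obtain Y where "countable Y" "Y \<subseteq> X" "C = A ` Y"
    by (metis countable_subset_image)
  then show ?thesis
    using that C(3) by auto
qed

section \<open>A version of the model that is noncontextual on the full supports\<close>

text \<open>Changes on null sets leave all integrals, hence Born's rule, intact. The delicate point
  is that the changed responses must still sum to 1 at every ontic state. The version is adapted to
  the given \<open>\<psi>\<close>.\<close>

lemma version_noncontextual:
  fixes S :: "('h::complex_hilbert, 'l, 'p, 'm, 'i) ontic_data"
  assumes model: "ontological_model S" and \<psi>: "norm \<psi> = 1"
    and sigma_finite: "sigma_finite_measure (ontic S)"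
  obtains S' where "version_of S' S"
    and "\<And>l. l \<in> orthocomplement_support S' UNIV \<psi> \<union> state_support S' UNIV \<psi> \<Longrightarrow>
      noncontextual S' UNIV \<psi> l"
proof -
  interpret sigma_finite_measure "ontic S" by fact
  define i0 where "i0 M = (THE i. joint_setting S \<psi> M i)" for M
  have i0: "i0 M = i" if "joint_setting S \<psi> M i" for M i
    unfolding i0_def using that joint_setting_unique[OF \<psi> _ that] by (rule the_equality)
  \<comment> \<open>For a setting that does not measure \<open>\<psi>\<close> jointly,
    \<open>i0 M\<close> is an unspecified value; membership in \<open>J\<close> excludes these
    settings.\<close>
  define J where "J = {M. joint_setting S \<psi> M (i0 M)}"
  have i0_outcome: "i0 M \<in> outcomes S M" if "M \<in> J" for M
    using that joint_setting_outcome[of S \<psi>] by (auto simp: J_def)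
  define X0 where "X0 = {P. cinner \<psi> (prepared S P) = 0}"
  define X1 where "X1 = {P. ketbra (prepared S P) = ketbra \<psi>}"
  let ?A = "\<lambda>P. {l\<in>space (ontic S). rho S P l > 0}"
  obtain Y0 where Y0: "Y0 \<subseteq> X0" "countable Y0"
      "\<And>P. P \<in> X0 \<Longrightarrow> ?A P - (\<Union>Q\<in>Y0. ?A Q) \<in> null_sets (ontic S)"
    using countable_essential_UN[of X0 ?A] support_in_sets[OF model] by blast
  obtain Y1 where Y1: "Y1 \<subseteq> X1" "countable Y1"
      "\<And>P. P \<in> X1 \<Longrightarrow> ?A P - (\<Union>Q\<in>Y1. ?A Q) \<in> null_sets (ontic S)"
    using countable_essential_UN[of X1 ?A] support_in_sets[OF model] by blast
  define A0 where "A0 = (\<Union>Q\<in>Y0. ?A Q)"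
  define A1 where "A1 = (\<Union>Q\<in>Y1. ?A Q)"
  have A0: "A0 \<in> sets (ontic S)" and A1: "A1 \<in> sets (ontic S)"
    using Y0(2) Y1(2) support_in_sets[OF model] unfolding A0_def A1_def
    by (auto intro!: sets.countable_UN')
  \<comment> \<open>\<open>A0\<close> is a union over the countable \<open>Y0\<close>, so for each
    \<open>M\<close> a single null set covers all the exceptions on it.\<close>
  have xi_A0: "AE l in ontic S. l \<in> A0 \<longrightarrow> xi S M (i0 M) l = 0" if "M \<in> J" for M
  proof -
    have "AE l in ontic S. \<forall>Q\<in>Y0. rho S Q l > 0 \<longrightarrow> xi S M (i0 M) l = 0"
      using that Y0(1,2)
      by (intro AE_ball_countable' AE_xi_eq_0[OF model, of \<psi>]) (auto simp: J_def X0_def)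
    then show ?thesis
      by eventually_elim (auto simp: A0_def)
  qed
  have xi_A1: "AE l in ontic S. l \<in> A1 \<longrightarrow> xi S M (i0 M) l = 1" if "M \<in> J" for M
  proof -
    have "AE l in ontic S. \<forall>Q\<in>Y1. rho S Q l > 0 \<longrightarrow> xi S M (i0 M) l = 1"
      using that Y1(1,2)
      by (intro AE_ball_countable' AE_xi_eq_1[OF model, of \<psi>]) (auto simp: J_def X1_def)
    then show ?thesis
      by eventually_elim (auto simp: A1_def)
  qed
  \<comment> \<open>Where the response to \<open>\<psi>\<close> is reset to 0, another outcome must
    carry probability 1. It exists once some prepared state is orthogonal to \<open>\<psi>\<close>,
    which a nonempty \<open>A0\<close> guarantees.\<close>
  have "\<exists>j\<in>outcomes S M. j \<noteq> i0 M" if M: "M \<in> J" and "A0 \<noteq> {}" for M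
  proof -
    obtain P where P: "cinner \<psi> (prepared S P) = 0"
      using \<open>A0 \<noteq> {}\<close> Y0(1) by (auto simp: A0_def X0_def)
    obtain b where "orthonormal_basis (outcomes S M) b" "b (i0 M) = \<psi>"
      using M by (auto simp: J_def joint_setting_def)
    then show ?thesis
      using orthonormal_basis_ex_other[of "outcomes S M" b "i0 M" "prepared S P"] P
        norm_prepared[OF model, of P] by (metis norm_zero zero_neq_one)
  qed
  then obtain j where j: "\<And>M. M \<in> J \<Longrightarrow> A0 \<noteq> {} \<Longrightarrow> j M \<in> outcomes S M \<and> j M \<noteq> i0 M"
    by metis
  text \<open>The sets \<open>A0\<close> and \<open>A1\<close> meet in a null set as soon as there is a joint setting; giving up
    \<open>A0 \<inter> A1\<close> makes the required responses 0 and 1 compatible.\<close>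
  define rho' where "rho' P l =
    (if J \<noteq> {} \<and> (P \<in> X0 \<and> l \<notin> A0 - A1 \<or> P \<in> X1 \<and> l \<notin> A1) then 0 else rho S P l)" for P l
  define N0 where "N0 M = {l\<in>space (ontic S). l \<in> A0 - A1 \<and> xi S M (i0 M) l \<noteq> 0}" for M
  define N1 where "N1 M = {l\<in>space (ontic S). l \<in> A1 \<and> xi S M (i0 M) l \<noteq> 1}" for M
  \<comment> \<open>All outcomes are redefined together: the response is the point mass at
    \<open>j M\<close> on \<open>N0 M\<close> and at \<open>i0 M\<close> on \<open>N1 M\<close>.
    These sets are disjoint, since \<open>N0 M\<close> avoids \<open>A1\<close>.\<close>
  define xi' where "xi' M i l =
    (if M \<in> J \<and> l \<in> N0 M then of_bool (i = j M)
     else if M \<in> J \<and> l \<in> N1 M then of_bool (i = i0 M) else xi S M i l)" for M i l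
  define S' where "S' = S\<lparr>rho := rho', xi := xi'\<rparr>"
  have S'_simps: "ontic S' = ontic S" "prepared S' = prepared S" "outcomes S' = outcomes S"
      "effect S' = effect S" "rho S' = rho'" "xi S' = xi'"
    by (simp_all add: S'_def)
  have N_sets: "N0 M \<in> sets (ontic S)" "N1 M \<in> sets (ontic S)" if "M \<in> J" for M
    using xi_measurable[OF model i0_outcome[OF that]] A0 A1 unfolding N0_def N1_def by measurable
  have AE_xi': "AE l in ontic S. xi' M i l = xi S M i l" for M i
  proof (cases "M \<in> J")
    case True
    show ?thesis
      using xi_A0[OF True] xi_A1[OF True]
      by eventually_elim (auto simp: xi'_def N0_def N1_def)
  qed (simp add: xi'_def)
  have AE_rho': "AE l in ontic S. rho' P l = rho S P l" for P
  proof (cases "J = {}")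
    case False
    then obtain M where M: "M \<in> J"
      by blast
    \<comment> \<open>One joint setting suffices: on the overlap its response would almost
      everywhere be both 0 and 1.\<close>
    have disj: "AE l in ontic S. l \<notin> A0 \<inter> A1"
      using xi_A0[OF M] xi_A1[OF M] by eventually_elim auto
    \<comment> \<open>Outside \<open>?A P\<close> the density is already 0, so the cut-off changes
      it only on the part of \<open>?A P\<close> missed by the essential union, or on the overlap of
      \<open>A0\<close> and \<open>A1\<close>.\<close>
    have "AE l in ontic S. P \<in> X0 \<longrightarrow> l \<notin> ?A P - A0"
      using AE_not_in[OF Y0(3)[of P]] unfolding A0_def[symmetric]
      by (cases "P \<in> X0") simp_all
    moreover have "AE l in ontic S. P \<in> X1 \<longrightarrow> l \<notin> ?A P - A1"
      using AE_not_in[OF Y1(3)[of P]] unfolding A1_def[symmetric]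
      by (cases "P \<in> X1") simp_all
    ultimately show ?thesis
      using disj AE_space
    proof eventually_elim
      case (elim l)
      then show ?case
        using rho_nonneg[OF model, of l P] by (auto simp: rho'_def)
    qed
  qed (simp add: rho'_def)
  have meas_rho': "rho' P \<in> borel_measurable (ontic S)" for P
    using rho_measurable[OF model, of P] A0 A1 unfolding rho'_def by measurable
  have meas_xi': "xi' M i \<in> borel_measurable (ontic S)" if "i \<in> outcomes S M" for M i
  proof (cases "M \<in> J")
    case True
    show ?thesis
      using xi_measurable[OF model that] N_sets[OF True] unfolding xi'_def by measurable
  next
    case False
    then have "xi' M i = xi S M i"
      by (simp add: xi'_def fun_eq_iff)
    then show ?thesis
      using xi_measurable[OF model that] by simp
  qed
  have has_sum_of_bool: "((\<lambda>i. of_bool (i = k) :: real) has_sum 1) I" if "k \<in> I" for k :: 'i and I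
    using that by (subst has_sum_cong_neutral[where T = "{k}" and g = "\<lambda>_. 1"])
      (auto intro!: has_sum_finiteI)
  have "ontological_model S'"
    unfolding ontological_model_def S'_simps
  proof (intro conjI allI ballI)
    fix P
    show "norm (prepared S P) = 1"
      by (rule norm_prepared[OF model])
    show "0 \<le> rho' P l" if "l \<in> space (ontic S)" for l
      using rho_nonneg[OF model that] by (simp add: rho'_def)
    show "integrable (ontic S) (rho' P)"
      using integrable_cong_AE[OF meas_rho' rho_measurable[OF model] AE_rho']
        rho_integrable[OF model] by blast
    show "(LINT l|ontic S. rho' P l) = 1"
      using integral_cong_AE[OF meas_rho' rho_measurable[OF model] AE_rho']
        rho_integral[OF model] by simp
  next
    fix M
    show "povm (outcomes S M) (effect S M)"
      using model by (simp add: ontological_model_def)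
    show "xi' M i \<in> borel_measurable (ontic S)" if "i \<in> outcomes S M" for i
      using that by (rule meas_xi')
    show "0 \<le> xi' M i l" if "l \<in> space (ontic S)" "i \<in> outcomes S M" for l i
      using xi_nonneg[OF model that] by (simp add: xi'_def)
    show "((\<lambda>i. xi' M i l) has_sum 1) (outcomes S M)" if "l \<in> space (ontic S)" for l
    proof -
      consider "M \<in> J" "l \<in> N0 M" | "M \<in> J" "l \<notin> N0 M" "l \<in> N1 M"
        | "M \<notin> J \<or> l \<notin> N0 M \<and> l \<notin> N1 M"
        by blast
      then show ?thesis
      proof cases
        case 1
        \<comment> \<open>The point \<open>l\<close> itself shows that \<open>A0\<close> is
          nonempty, as the choice of \<open>j\<close> requires.\<close>
        then have "j M \<in> outcomes S M"
          using j[of M] by (auto simp: N0_def)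
        then show ?thesis
          using 1 by (simp add: xi'_def has_sum_of_bool)
      next
        case 2
        then show ?thesis
          by (simp add: xi'_def has_sum_of_bool i0_outcome)
      next
        case 3
        then show ?thesis
          using xi_has_sum[OF model that, of M] by (auto simp: xi'_def cong: has_sum_cong)
      qed
    qed
  next
    fix P M i
    assume i: "i \<in> outcomes S M"
    have "AE l in ontic S. xi' M i l * rho' P l = xi S M i l * rho S P l"
      using AE_xi'[of M i] AE_rho'[of P] by eventually_elim simp
    then have "(LINT l|ontic S. xi' M i l * rho' P l) = (LINT l|ontic S. xi S M i l * rho S P l)"
      using meas_xi'[OF i] meas_rho'[of P] xi_measurable[OF model i] rho_measurable[OF model, of P]
      by (intro integral_cong_AE) auto
    then show "complex_of_real (LINT l|ontic S. xi' M i l * rho' P l) =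
        cinner (prepared S P) (effect S M i (prepared S P))"
      using born[OF model i] by simp
  qed
  then have version: "version_of S' S"
    using AE_xi' AE_rho' by (simp add: version_of_def S'_simps)
  have i0': "M \<in> J \<and> i0 M = i" if "joint_setting S' \<psi> M i" for M i
  proof -
    have "joint_setting S \<psi> M i"
      using that by (simp add: joint_setting_def S'_simps)
    then show ?thesis
      using i0[of M i] by (simp add: J_def)
  qed
  have "noncontextual S' UNIV \<psi> l"
    if "l \<in> orthocomplement_support S' UNIV \<psi> \<union> state_support S' UNIV \<psi>" for l
  proof (cases "J = {}")
    case True
    then show ?thesis
      using i0' by (intro noncontextualI) blast
  next
    case False
    have "norm (prepared S' P) = 1" for P
      by (simp add: S'_simps norm_prepared[OF model])
    note support' = orthocomplement_support_eq[of S', OF this]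
    from that show ?thesis
    proof
      assume "l \<in> orthocomplement_support S' UNIV \<psi>"
      then obtain P where "P \<in> X0" "l \<in> space (ontic S)" "rho' P l > 0"
        unfolding support' by (auto simp: S'_simps X0_def)
      \<comment> \<open>After the cut-off, positive density implies this membership at every point.
        There the response was already 0, or \<open>l\<close> lies in \<open>N0 M\<close> and the
        point mass sits at \<open>j M\<close>, which differs from \<open>i0 M\<close>.\<close>
      then have "l \<in> A0 - A1" "l \<in> space (ontic S)"
        using False by (auto simp: rho'_def split: if_splits)
      then show ?thesis
        using i0' j by (intro noncontextualI[where c = 0])
          (fastforce simp: S'_simps xi'_def N0_def N1_def)
    next
      assume "l \<in> state_support S' UNIV \<psi>"
      then obtain P where "P \<in> X1" "l \<in> space (ontic S)" "rho' P l > 0"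
        by (auto simp: S'_simps X1_def state_support_def)
      \<comment> \<open>On \<open>A1\<close> the response either was already 1 or was replaced by
        the point mass at \<open>i0 M\<close>.\<close>
      then have "l \<in> A1" "l \<in> space (ontic S)"
        using False by (auto simp: rho'_def split: if_splits)
      then show ?thesis
        using i0' by (intro noncontextualI[where c = 1])
          (fastforce simp: S'_simps xi'_def N0_def N1_def)
    qed
  qed
  with version show ?thesis
    using that by blast
qed

theorem mainTheorem4:
  fixes S :: "('h::complex_hilbert, 'l, 'p, 'm, 'i) ontic_data"
    and \<psi> :: 'h
  assumes "ontological_model S"
    and "norm \<psi> = 1"
  shows "(\<forall>Ps Ms. countable Ps \<longrightarrow> countable Ms \<longrightarrow>
           (AE l in ontic S.
             l \<in> orthocomplement_support S Ps \<psi> \<union> state_support S Ps \<psi> \<longrightarrow>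
             noncontextual S Ms \<psi> l)) \<and>
         (\<forall>l. emeasure (ontic S) {l} > 0 \<longrightarrow>
             l \<in> orthocomplement_support S UNIV \<psi> \<union> state_support S UNIV \<psi> \<longrightarrow>
             noncontextual S UNIV \<psi> l) \<and>
         (sigma_finite_measure (ontic S) \<longrightarrow>
           (\<exists>S'. version_of S' S \<and>
             (\<forall>l \<in> orthocomplement_support S' UNIV \<psi> \<union> state_support S' UNIV \<psi>.
               noncontextual S' UNIV \<psi> l)))"
proof (intro conjI allI impI)
  show "AE l in ontic S. l \<in> orthocomplement_support S Ps \<psi> \<union> state_support S Ps \<psi> \<longrightarrow>
      noncontextual S Ms \<psi> l" if "countable Ps" "countable Ms" for Ps Ms
    using AE_noncontextual_countable[OF assms that] .
  show "noncontextual S UNIV \<psi> l" if "emeasure (ontic S) {l} > 0"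
    "l \<in> orthocomplement_support S UNIV \<psi> \<union> state_support S UNIV \<psi>" for l
    using noncontextual_atom[OF assms(1) that] .
  show "\<exists>S'. version_of S' S \<and>
      (\<forall>l \<in> orthocomplement_support S' UNIV \<psi> \<union> state_support S' UNIV \<psi>.
        noncontextual S' UNIV \<psi> l)" if "sigma_finite_measure (ontic S)"
    using version_noncontextual[OF assms that] by metis
qed

end
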